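(* Let $X$ be a Hausdorff space. (a) There is an embedding of $X$ into the branch space $\mathcal{B}(T)$ of a tree $T$ if and only if $X$ admits a nested base. (b) There is an embedding of $X$ into the branch space $\mathcal{B}(T)$ of a special tree $T$ if and only if $X$ admits a nested base that is $\sigma$-disjoint. (c) There is a surjective embedding of $X$ into (i.e. $X$ is homeomorphic to) the branch space $\mathcal{B}(T)$ of a tree $T$ if and only if $X$ admits a complete nested base. (d) There is a surjective embedding of $X$ into (i.e. $X$ is homeomorphic to) the branch space $\mathcal{B}(T)$ of a special tree $T$ if and only if $X$ admits a complete nested base that is $\sigma$-disjoint.
   Context: A tree is a partially ordered set $T$ with a unique minimal element such that the set of predecessors of any element is well-ordered (distinct limit nodes may have the same set of strict predecessors). It is special if it is a union of countably many antichains. A path in $T$ is a down-closed chain, and a branch of $T$ is an inclusion-wise maximal path. The branch space $\mathcal{B}(T)$ is the set of all branches of $T$ with the subspace topology inherited from $2^T$ (product topology), branches being identified with their characteristic functions. "Base" means base of open sets for the topology. A collection $\mathcal{A}$ of sets is nested if for all $A,B\in\mathcal{A}$ with $A\cap B\neq\emptyset$ we have $A\subseteq B$ or $B\subseteq A$; centered if any finite subfamily of $\mathcal{A}$ has nonempty intersection; complete if any centered subfamily of $\mathcal{A}$ has nonempty intersection; $\sigma$-disjoint if $\mathcal{A}$ is a countable union of subcollections each consisting of pairwise disjoint sets. *)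

theory Defs
  imports "HOL-Analysis.Analysis"
begin

text \<open>A tree is given by its reflexive order relation \<open>T\<close>; its set of nodes is \<open>Field T\<close>.
  Distinct nodes of limit height may have the same strict predecessors.\<close>

definition tree :: "'b rel \<Rightarrow> bool" where
  "tree T \<longleftrightarrow>
     Partial_order T \<and>
     (\<exists>!m. m \<in> Field T \<and> (\<forall>s. (s, m) \<in> T \<longrightarrow> s = m)) \<and>
     (\<forall>t\<in>Field T. well_order_on (underS T t) (Restr T (underS T t)))"

definition antichain :: "'b rel \<Rightarrow> 'b set \<Rightarrow> bool" where
  "antichain T A \<longleftrightarrow> A \<subseteq> Field T \<and> (\<forall>s\<in>A. \<forall>t\<in>A. (s, t) \<in> T \<longrightarrow> s = t)"

definition special :: "'b rel \<Rightarrow> bool" where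
  "special T \<longleftrightarrow> (\<exists>A :: nat \<Rightarrow> 'b set. (\<forall>n. antichain T (A n)) \<and> Field T = (\<Union>n. A n))"

definition tree_path :: "'b rel \<Rightarrow> 'b set \<Rightarrow> bool" where
  "tree_path T P \<longleftrightarrow> P \<subseteq> Field T \<and> P \<in> Chains T \<and> (\<forall>t\<in>P. under T t \<subseteq> P)"

definition branch :: "'b rel \<Rightarrow> 'b set \<Rightarrow> bool" where
  "branch T b \<longleftrightarrow> tree_path T b \<and> (\<forall>P. tree_path T P \<and> b \<subseteq> P \<longrightarrow> P = b)"

text \<open>The factor \<open>2\<close> of the product is the discrete space \<^typ>\<open>bool\<close>. Points of
  \<^const>\<open>product_topology\<close> are functions that are \<^const>\<open>undefined\<close> outside the index
  set, so characteristic functions are restricted to the nodes of the tree.\<close>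

definition branch_space :: "'b rel \<Rightarrow> ('b \<Rightarrow> bool) topology" where
  "branch_space T =
     subtopology (product_topology (\<lambda>_. discrete_topology UNIV) (Field T))
       {(\<lambda>t\<in>Field T. t \<in> b) | b. branch T b}"

definition base_of :: "'a topology \<Rightarrow> 'a set set \<Rightarrow> bool" where
  "base_of X \<B> \<longleftrightarrow>
     (\<forall>B\<in>\<B>. openin X B) \<and>
     (\<forall>U x. openin X U \<and> x \<in> U \<longrightarrow> (\<exists>B\<in>\<B>. x \<in> B \<and> B \<subseteq> U))"

definition nested :: "'a set set \<Rightarrow> bool" where
  "nested \<A> \<longleftrightarrow> (\<forall>A\<in>\<A>. \<forall>B\<in>\<A>. A \<inter> B \<noteq> {} \<longrightarrow> A \<subseteq> B \<or> B \<subseteq> A)"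

definition centered :: "'a set set \<Rightarrow> bool" where
  "centered \<C> \<longleftrightarrow> (\<forall>\<F>. \<F> \<subseteq> \<C> \<and> finite \<F> \<and> \<F> \<noteq> {} \<longrightarrow> \<Inter>\<F> \<noteq> {})"

text \<open>Intersections are taken inside the space, so the empty subfamily, which is centered,
  has intersection \<open>topspace X\<close>. This matters only for the empty space: no family is complete
  there, in accordance with the fact that the branch space of a tree is never empty. For a
  nonempty space the conventions for the empty subfamily are irrelevant.\<close>

definition complete_family :: "'a topology \<Rightarrow> 'a set set \<Rightarrow> bool" where
  "complete_family X \<A> \<longleftrightarrow> (\<forall>\<C>. \<C> \<subseteq> \<A> \<and> centered \<C> \<longrightarrow> topspace X \<inter> \<Inter>\<C> \<noteq> {})"

definition sigma_disjoint :: "'a set set \<Rightarrow> bool" where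
  "sigma_disjoint \<A> \<longleftrightarrow> (\<exists>\<D> :: nat \<Rightarrow> 'a set set. (\<forall>n. disjoint (\<D> n)) \<and> \<A> = (\<Union>n. \<D> n))"

definition embeds_in :: "'a topology \<Rightarrow> 'c topology \<Rightarrow> bool" where
  "embeds_in X Y \<longleftrightarrow> (\<exists>f. embedding_map X Y f)"

definition embeds_onto :: "'a topology \<Rightarrow> 'c topology \<Rightarrow> bool" where
  "embeds_onto X Y \<longleftrightarrow> (\<exists>f. embedding_map X Y f \<and> f ` topspace X = topspace Y)"

end

theory Submission
  imports Defs
begin

text \<open>In a branch space the sets \<open>[t]\<close> of all branches through a node \<open>t\<close> form a nested base, because
  a node outside a branch \<open>b\<close> is incomparable with some node of \<open>b\<close>. Antichains of nodes give
  disjoint families, and Zorn's lemma gives completeness; everything pulls back along an embedding.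

  For the converse one needs a nested base that is a tree under reverse inclusion. It cannot in
  general be found inside the given nested base \<open>\<B>\<close>: in the Baire space, the sets of all sequences
  that extend \<open>s\<close> by a value at most \<open>n\<close> form a nested base without such a subfamily. Instead,
  starting from the whole space, every region \<open>I\<close> with at least two points is partitioned into open
  sets \<open>V\<close>, each with some \<open>D \<in> \<B>\<close> such that \<open>V \<subseteq> D \<subset> I\<close>, and this is iterated transfinitely,
  with intersections at limits. The interleaved sets \<open>D\<close> carry completeness and
  \<open>\<sigma>\<close>-disjointness from \<open>\<B>\<close> over to the new base.\<close>

section \<open>Branch spaces have nested bases\<close>

lemma tree_below_comparable:
  assumes "tree T" "(s, u) \<in> T" "(t, u) \<in> T"
  shows "(s, t) \<in> T \<or> (t, s) \<in> T"
proof -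
  have refl: "(v, v) \<in> T" if "v \<in> Field T" for v
    using assms(1) that by (auto simp: tree_def order_on_defs refl_on_def)
  have F: "s \<in> Field T" "t \<in> Field T" "u \<in> Field T"
    using assms(2,3) by (auto simp: Field_def)
  then have "total_on (underS T u) (Restr T (underS T u))"
    using assms(1) by (auto simp: tree_def order_on_defs)
  then show ?thesis
    using assms(2,3) F refl by (cases "s = u"; cases "t = u"; cases "s = t") (auto simp: total_on_def underS_def)
qed

lemma tree_path_Union:
  assumes "\<C> \<noteq> {}" "\<And>P. P \<in> \<C> \<Longrightarrow> tree_path T P"
    "\<And>P Q. P \<in> \<C> \<Longrightarrow> Q \<in> \<C> \<Longrightarrow> P \<subseteq> Q \<or> Q \<subseteq> P"
  shows "tree_path T (\<Union>\<C>)"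
proof -
  have "(s, t) \<in> T \<or> (t, s) \<in> T" if st: "s \<in> P" "P \<in> \<C>" "t \<in> Q" "Q \<in> \<C>" for s t P Q
  proof -
    obtain R where "R \<in> \<C>" "s \<in> R" "t \<in> R"
      using assms(3)[of P Q] st by blast
    then show ?thesis
      using assms(2)[of R] by (auto simp: tree_path_def Chains_def)
  qed
  then show ?thesis
    using assms(2) by (simp add: tree_path_def Chains_def Union_least) blast
qed

text \<open>Nodes below two elements of the chain \<open>S\<close> both lie below the larger of
  these, where \<open>tree_below_comparable\<close> applies.\<close>

lemma tree_path_down_closure:
  assumes "tree T" "S \<in> Chains T"
  shows "tree_path T (\<Union>s\<in>S. under T s)"
proof -
  have tr: "trans T"
    using assms(1) by (auto simp: tree_def order_on_defs)
  have "(x, y) \<in> T \<or> (y, x) \<in> T"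
    if xy: "(x, s) \<in> T" "(y, t) \<in> T" "s \<in> S" "t \<in> S" for x y s t
  proof -
    consider "(s, t) \<in> T" | "(t, s) \<in> T"
      using assms(2) xy by (auto simp: Chains_def)
    then show ?thesis
      using tree_below_comparable[OF assms(1)] xy tr by cases (meson transD)+
  qed
  moreover have "under T x \<subseteq> under T s" if "(x, s) \<in> T" for x s
    using tr that by (auto simp: under_def dest: transD)
  ultimately show ?thesis
    unfolding tree_path_def Chains_def under_def by (blast intro: FieldI1)
qed

text \<open>Zorn's lemma, applied to the paths that contain the down-closure of
  \<open>S\<close>.\<close>

lemma chain_subset_branch:
  assumes "tree T" "S \<in> Chains T"
  obtains b where "branch T b" "S \<subseteq> b"
proof -
  let ?P = "\<Union>s\<in>S. under T s"
  let ?A = "{P. tree_path T P \<and> ?P \<subseteq> P}"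
  have "S \<subseteq> ?P"
    using assms(2) by (auto simp: under_def Chains_def)
  have "\<exists>M\<in>?A. \<forall>Y\<in>?A. M \<subseteq> Y \<longrightarrow> Y = M"
  proof (rule subset_Zorn_nonempty)
    show "?A \<noteq> {}"
      using tree_path_down_closure[OF assms] by blast
    show "\<Union>\<C> \<in> ?A" if "\<C> \<noteq> {}" "subset.chain ?A \<C>" for \<C>
    proof -
      have C: "P \<in> \<C> \<Longrightarrow> P \<in> ?A" "P \<in> \<C> \<Longrightarrow> Q \<in> \<C> \<Longrightarrow> P \<subseteq> Q \<or> Q \<subseteq> P" for P Q
        using that(2) by (auto simp: subset_chain_def)
      then have "tree_path T (\<Union>\<C>)"
        using that(1) by (intro tree_path_Union) auto
      moreover have "?P \<subseteq> \<Union>\<C>"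
        using that(1) C(1) by blast
      ultimately show ?thesis
        by simp
    qed
  qed
  then obtain b where b: "b \<in> ?A" "\<forall>Y\<in>?A. b \<subseteq> Y \<longrightarrow> Y = b"
    by (rule bexE)
  have "branch T b"
    unfolding branch_def using b subset_trans[of ?P b] by blast
  then show thesis
    using that[of b] \<open>S \<subseteq> ?P\<close> b(1) by (simp add: subset_trans)
qed

lemma branch_maximal_chain:
  assumes "tree T" "branch T b" "S \<in> Chains T" "b \<subseteq> S"
  shows "S = b"
proof -
  obtain c where "branch T c" "S \<subseteq> c"
    using chain_subset_branch[OF assms(1,3)] .
  then show ?thesis
    using assms(2,4) unfolding branch_def by blast
qed

lemma branch_chain:
  assumes "branch T b" "s \<in> b" "t \<in> b"
  shows "(s, t) \<in> T \<or> (t, s) \<in> T"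
  using assms by (auto simp: branch_def tree_path_def Chains_def)

text \<open>Otherwise \<open>insert s b\<close> would be a larger chain. The absence of
  \<open>s\<close> is thereby witnessed by the presence of another node.\<close>

lemma branch_separation:
  assumes "tree T" "branch T b" "s \<in> Field T" "s \<notin> b"
  obtains t where "t \<in> b" "(s, t) \<notin> T" "(t, s) \<notin> T"
proof -
  have "(s, s) \<in> T"
    using assms(1,3) by (auto simp: tree_def order_on_defs refl_on_def)
  moreover have "insert s b \<notin> Chains T"
    using branch_maximal_chain[OF assms(1,2)] assms(4) by blast
  ultimately show thesis
    using that branch_chain[OF assms(2)] by (auto simp: Chains_def)
qed

lemma branch_nonempty:
  assumes "tree T" "branch T b"
  shows "b \<noteq> {}"
proof
  assume "b = {}"
  obtain s where "s \<in> Field T"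
    using assms(1) by (auto simp: tree_def)
  then show False
    using branch_separation[OF assms] \<open>b = {}\<close> by blast
qed

lemma branch_subset_Field: "branch T b \<Longrightarrow> b \<subseteq> Field T"
  by (simp add: branch_def tree_path_def)

lemma branch_down_closed: "branch T b \<Longrightarrow> t \<in> b \<Longrightarrow> (s, t) \<in> T \<Longrightarrow> s \<in> b"
  by (auto simp: branch_def tree_path_def under_def)

section \<open>The standard base of a branch space\<close>

lemma topspace_branch_space:
  "topspace (branch_space T) = {(\<lambda>t\<in>Field T. t \<in> b) | b. branch T b}"
  by (auto simp: branch_space_def)

lemma openin_branch_space_through:
  assumes "t \<in> Field T"
  shows "openin (branch_space T) {\<phi> \<in> topspace (branch_space T). \<phi> t}"
proof -
  have "continuous_map (branch_space T) (discrete_topology UNIV) (\<lambda>\<phi>. \<phi> t)"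
    unfolding branch_space_def
    using assms by (intro continuous_map_from_subtopology continuous_map_product_projection)
  from openin_continuous_map_preimage[OF this, of "{True}"] show ?thesis
    by simp
qed

text \<open>This merges finitely many conditions on a branch into passage through a single node. For
  empty \<open>J\<close> any node of the branch will do.\<close>

lemma finite_subset_branch_le:
  assumes "tree T" "branch T b" "finite J" "J \<subseteq> b"
  obtains t where "t \<in> b" "\<And>s. s \<in> J \<Longrightarrow> (s, t) \<in> T"
proof -
  have "\<exists>t\<in>b. \<forall>s\<in>J. (s, t) \<in> T"
    using assms(3,4)
  proof (induction J)
    case empty
    then show ?case
      using branch_nonempty[OF assms(1,2)] by auto
  next
    case (insert u J)
    then obtain t where t: "t \<in> b" "\<forall>s\<in>J. (s, t) \<in> T" by auto
    have "trans T"
      using assms(1) by (auto simp: tree_def order_on_defs)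
    moreover have "(u, u) \<in> T"
      using branch_chain[OF assms(2), of u u] insert.prems by auto
    ultimately show ?case
      using t insert.prems branch_chain[OF assms(2), of u t]
      by (metis insert_iff insert_subset transD)
  qed
  then show thesis
    using that by blast
qed

lemma base_of_branch_space:
  assumes "tree T"
  shows "base_of (branch_space T) ((\<lambda>t. {\<phi> \<in> topspace (branch_space T). \<phi> t}) ` Field T)"
  unfolding base_of_def
proof (intro conjI ballI allI impI)
  let ?Y = "branch_space T"
  fix U \<phi> assume U: "openin ?Y U \<and> \<phi> \<in> U"
  obtain S where S: "openin (product_topology (\<lambda>_. discrete_topology UNIV) (Field T)) S"
    "U = S \<inter> topspace ?Y"
    using U unfolding topspace_branch_space
    by (subst (asm) (1) branch_space_def) (auto simp: openin_subtopology)
  obtain b where b: "branch T b" "\<phi> = (\<lambda>t\<in>Field T. t \<in> b)"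
    using U S by (auto simp: topspace_branch_space)
  obtain V :: "'a \<Rightarrow> bool set" where V: "finite {i \<in> Field T. V i \<noteq> UNIV}"
    "\<phi> \<in> PiE (Field T) V" "PiE (Field T) V \<subseteq> S"
    using S U by (auto simp: openin_product_topology_alt)
  let ?J = "{i \<in> Field T. V i \<noteq> UNIV}"
  \<comment> \<open>A single node of \<open>b\<close> decides the coordinate \<open>i\<close>: the
    node \<open>i\<close> itself if \<open>i \<in> b\<close>, and otherwise a node incomparable with
    \<open>i\<close>, which keeps \<open>i\<close> out of every branch through it.\<close>
  have "\<exists>t\<in>b. \<forall>c. branch T c \<and> t \<in> c \<longrightarrow> (i \<in> c \<longleftrightarrow> i \<in> b)" if i: "i \<in> Field T" for i
  proof (cases "i \<in> b")
    case False
    then obtain t where "t \<in> b" "(i, t) \<notin> T" "(t, i) \<notin> T"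
      using branch_separation[OF assms b(1) i] by blast
    then show ?thesis
      using False branch_chain[of T _ i t] by blast
  qed blast
  then obtain \<tau> where \<tau>: "\<And>i. i \<in> Field T \<Longrightarrow> \<tau> i \<in> b"
    "\<And>i c. i \<in> Field T \<Longrightarrow> branch T c \<Longrightarrow> \<tau> i \<in> c \<Longrightarrow> i \<in> c \<longleftrightarrow> i \<in> b"
    by metis
  \<comment> \<open>Branches are down-closed, so a branch through \<open>t\<close> contains each
    \<open>\<tau> i\<close> with \<open>i \<in> ?J\<close> and agrees with \<open>b\<close> on
    \<open>?J\<close>.\<close>
  obtain t where t: "t \<in> b" "\<And>s. s \<in> \<tau> ` ?J \<Longrightarrow> (s, t) \<in> T"
    using finite_subset_branch_le[OF assms b(1), of "\<tau> ` ?J"] V(1) \<tau>(1) by blast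
  have tF: "t \<in> Field T"
    using t branch_subset_Field b by blast
  show "\<exists>B\<in>(\<lambda>t. {\<phi> \<in> topspace ?Y. \<phi> t}) ` Field T. \<phi> \<in> B \<and> B \<subseteq> U"
  proof (intro bexI conjI)
    show "{\<psi> \<in> topspace ?Y. \<psi> t} \<in> (\<lambda>t. {\<phi> \<in> topspace ?Y. \<phi> t}) ` Field T"
      using tF by blast
    show "\<phi> \<in> {\<psi> \<in> topspace ?Y. \<psi> t}"
      using U S b t tF by auto
    show "{\<psi> \<in> topspace ?Y. \<psi> t} \<subseteq> U"
    proof
      fix \<psi> assume \<psi>: "\<psi> \<in> {\<psi> \<in> topspace ?Y. \<psi> t}"
      then obtain c where c: "branch T c" "\<psi> = (\<lambda>t\<in>Field T. t \<in> c)"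
        by (auto simp: topspace_branch_space)
      have "t \<in> c"
        using \<psi> c tF by auto
      then have "i \<in> c \<longleftrightarrow> i \<in> b" if "i \<in> ?J" for i
        using \<tau>(2)[of i c] t(2)[of "\<tau> i"] c(1) that branch_down_closed by fastforce
      moreover have "(i \<in> b) \<in> V i" if "i \<in> Field T" for i
        using V(2) that b(2) by (auto simp: PiE_iff)
      ultimately have "(i \<in> c) \<in> V i" if "i \<in> Field T" for i
        using that by (cases "V i = UNIV") auto
      then have "\<psi> \<in> PiE (Field T) V"
        using c(2) by (fastforce simp: PiE_iff)
      then show "\<psi> \<in> U"
        using V(3) S(2) \<psi> by blast
    qed
  qed
next
  fix B assume "B \<in> (\<lambda>t. {\<phi> \<in> topspace (branch_space T). \<phi> t}) ` Field T"
  then show "openin (branch_space T) B"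
    by (rule imageE) (simp only: openin_branch_space_through)
qed

section \<open>Pulling the base back along an embedding\<close>

lemma base_of_embedding_preimage:
  assumes "embedding_map X Y f" "base_of Y \<B>"
  shows "base_of X ((\<lambda>B. {x \<in> topspace X. f x \<in> B}) ` \<B>)"
  unfolding base_of_def
proof (intro conjI ballI allI impI)
  have hom: "homeomorphic_map X (subtopology Y (f ` topspace X)) f"
    using assms(1) by (simp add: embedding_map_def)
  fix U x assume U: "openin X U \<and> x \<in> U"
  then have "openin (subtopology Y (f ` topspace X)) (f ` U)"
    using hom openin_subset by (metis homeomorphic_map_openness)
  then obtain W where W: "openin Y W" "f ` U = W \<inter> f ` topspace X"
    by (auto simp: openin_subtopology)
  then obtain B where B: "B \<in> \<B>" "f x \<in> B" "B \<subseteq> W"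
    using assms(2) U unfolding base_of_def by (metis IntE imageI)
  have inj: "inj_on f (topspace X)"
    using assms(1) by (simp add: embedding_map_def homeomorphic_imp_injective_map)
  have sub: "U \<subseteq> topspace X"
    using U openin_subset by blast
  have "{x \<in> topspace X. f x \<in> B} \<subseteq> U"
  proof
    fix z assume "z \<in> {x \<in> topspace X. f x \<in> B}"
    then have "z \<in> topspace X" "f z \<in> f ` U"
      unfolding W(2) using B(3) by blast+
    then show "z \<in> U"
      using inj sub by (meson inj_on_image_mem_iff)
  qed
  then show "\<exists>B\<in>(\<lambda>B. {x \<in> topspace X. f x \<in> B}) ` \<B>. x \<in> B \<and> B \<subseteq> U"
    using B(1,2) sub U by (intro bexI[where x = "{x \<in> topspace X. f x \<in> B}"]) auto
next
  fix B assume "B \<in> (\<lambda>B. {x \<in> topspace X. f x \<in> B}) ` \<B>"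
  then obtain C where C: "C \<in> \<B>" "B = {x \<in> topspace X. f x \<in> C}"
    by blast
  have "continuous_map X Y f"
    using assms(1) continuous_map_into_fulltopology homeomorphic_imp_continuous_map
    unfolding embedding_map_def by metis
  then show "openin X B"
    using assms(2) C unfolding base_of_def by (simp add: openin_continuous_map_preimage)
qed

lemma centered_inter:
  assumes "centered \<C>" "A \<in> \<C>" "B \<in> \<C>"
  shows "A \<inter> B \<noteq> {}"
  using assms(1)[unfolded centered_def, rule_format, of "{A, B}"] assms(2,3) by simp

text \<open>One base serves all four parts: the preimages of the sets of branches through a
  node.\<close>

lemma nested_base_of_embedding:
  fixes T :: "'b rel" and X :: "'a topology"
  assumes T: "tree T" and f: "embedding_map X (branch_space T) f"
  obtains \<B> where "base_of X \<B>" "nested \<B>"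
    "special T \<Longrightarrow> sigma_disjoint \<B>"
    "f ` topspace X = topspace (branch_space T) \<Longrightarrow> complete_family X \<B>"
proof
  let ?Y = "branch_space T"
  define N where "N t = {x \<in> topspace X. f x t}" for t
  let ?B = "N ` Field T"
  have fY: "f x \<in> topspace ?Y" if "x \<in> topspace X" for x
    using f that by (auto simp: embedding_map_def homeomorphic_eq_everything_map)
  have "?B = (\<lambda>B. {x \<in> topspace X. f x \<in> B}) ` (\<lambda>t. {\<phi> \<in> topspace ?Y. \<phi> t}) ` Field T"
    using fY by (auto simp: N_def image_image intro!: image_cong)
  then show "base_of X ?B"
    using base_of_embedding_preimage[OF f base_of_branch_space[OF T]] by simp
  have comp: "(s, t) \<in> T \<or> (t, s) \<in> T"
    if st: "s \<in> Field T" "t \<in> Field T" "N s \<inter> N t \<noteq> {}" for s t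
  proof -
    obtain x where "x \<in> topspace X" "f x s" "f x t"
      using st unfolding N_def by blast
    moreover obtain b where "branch T b" "f x = (\<lambda>t\<in>Field T. t \<in> b)"
      using fY[OF \<open>x \<in> topspace X\<close>] by (auto simp: topspace_branch_space)
    ultimately show ?thesis
      using branch_chain[of T b s t] st by auto
  qed
  have mono: "N t \<subseteq> N s" if st: "(s, t) \<in> T" for s t
  proof
    fix x assume x: "x \<in> N t"
    then obtain b where b: "branch T b" "f x = (\<lambda>t\<in>Field T. t \<in> b)"
      using fY by (force simp: topspace_branch_space N_def)
    have "s \<in> Field T" "t \<in> Field T"
      using st by (auto simp: Field_def)
    then show "x \<in> N s"
      using x b branch_down_closed[OF b(1) _ st] by (auto simp: N_def)
  qed
  show "nested ?B"
    using comp mono unfolding nested_def by blast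
  show "sigma_disjoint ?B" if "special T"
  proof -
    from that obtain A where A: "\<And>n::nat. antichain T (A n)" "Field T = (\<Union>n. A n)"
      by (auto simp: special_def)
    have "disjoint (N ` A n)" for n
    proof (rule disjointI)
      fix a b assume "a \<in> N ` A n" "b \<in> N ` A n" "a \<noteq> b"
      then show "a \<inter> b = {}"
        using comp A(1)[of n] unfolding antichain_def by blast
    qed
    then show ?thesis
      unfolding sigma_disjoint_def by (intro exI[of _ "\<lambda>n. N ` A n"]) (auto simp: A(2))
  qed
  show "complete_family X ?B" if onto: "f ` topspace X = topspace ?Y"
    unfolding complete_family_def
  proof (intro allI impI, elim conjE)
    fix \<C> assume C: "\<C> \<subseteq> ?B" "centered \<C>"
    \<comment> \<open>Members of a centered family meet, so these nodes form a chain. A branch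
      containing it comes from a point by surjectivity. The empty family is covered as well.\<close>
    let ?S = "{t \<in> Field T. N t \<in> \<C>}"
    have "?S \<in> Chains T"
      using comp centered_inter[OF C(2)] by (auto simp: Chains_def)
    then obtain b where b: "branch T b" "?S \<subseteq> b"
      using chain_subset_branch[OF T] by blast
    then have "(\<lambda>t\<in>Field T. t \<in> b) \<in> f ` topspace X"
      unfolding onto topspace_branch_space by blast
    then obtain x where x: "x \<in> topspace X" "f x = (\<lambda>t\<in>Field T. t \<in> b)"
      by auto
    have "x \<in> N t" if "t \<in> Field T" "N t \<in> \<C>" for t
      using x b that by (auto simp: N_def)
    then show "topspace X \<inter> \<Inter>\<C> \<noteq> {}"
      using C(1) x(1) by blast
  qed
qed

section \<open>Splitting a region along a nested base\<close>

text \<open>The regions constructed below need not belong to \<open>\<B>\<close>; this is the share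
  of nestedness that they retain.\<close>

definition compatible :: "'a set set \<Rightarrow> 'a set \<Rightarrow> bool" where
  "compatible \<B> I \<longleftrightarrow> (\<forall>C\<in>\<B>. C \<inter> I \<noteq> {} \<longrightarrow> C \<subseteq> I \<or> I \<subseteq> C)"

lemma compatibleD: "compatible \<B> I \<Longrightarrow> C \<in> \<B> \<Longrightarrow> x \<in> C \<Longrightarrow> x \<in> I \<Longrightarrow> C \<subseteq> I \<or> I \<subseteq> C"
  unfolding compatible_def by blast

lemma nested_compatible: "nested \<B> \<Longrightarrow> C \<in> \<B> \<Longrightarrow> compatible \<B> C"
  unfolding nested_def compatible_def by blast

lemma nestedD: "nested \<B> \<Longrightarrow> C \<in> \<B> \<Longrightarrow> D \<in> \<B> \<Longrightarrow> x \<in> C \<Longrightarrow> x \<in> D \<Longrightarrow> C \<subseteq> D \<or> D \<subseteq> C"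
  unfolding nested_def by blast

text \<open>A member of \<open>\<B>\<close> that meets the intersection lies in every
  \<open>I\<close> or contains some \<open>I\<close>. This handles the limit stages.\<close>

lemma compatible_Inter:
  assumes "\<And>I. I \<in> \<M> \<Longrightarrow> compatible \<B> I"
  shows "compatible \<B> (\<Inter>\<M>)"
  using assms unfolding compatible_def by blast

lemma base_of_separation:
  assumes "Hausdorff_space X" "base_of X \<B>" "x \<in> topspace X" "y \<in> topspace X" "x \<noteq> y"
  obtains C where "C \<in> \<B>" "x \<in> C" "y \<notin> C"
proof -
  obtain U V where "openin X U" "openin X V" "x \<in> U" "y \<in> V" "disjnt U V"
    using assms(1,3-5) unfolding Hausdorff_space_def by meson
  then show thesis
    using assms(2) that unfolding base_of_def disjnt_iff by (metis subsetD)
qed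

text \<open>The partition is encoded by the map from points to cells; its constancy on each cell
  makes distinct cells disjoint.\<close>

definition is_split :: "'a topology \<Rightarrow> 'a set set \<Rightarrow> 'a set \<Rightarrow> ('a \<Rightarrow> 'a set) \<Rightarrow> bool" where
  "is_split X \<B> I g \<longleftrightarrow> (\<forall>x\<in>I. x \<in> g x \<and> (\<forall>y\<in>g x. g y = g x) \<and> openin X (g x) \<and>
     compatible \<B> (g x) \<and> (\<exists>D\<in>\<B>. g x \<subseteq> D \<and> D \<subset> I))"

lemma is_splitD:
  assumes "is_split X \<B> I g" "x \<in> I"
  shows "x \<in> g x" "\<And>y. y \<in> g x \<Longrightarrow> g y = g x" "openin X (g x)" "compatible \<B> (g x)"
    "\<exists>D\<in>\<B>. g x \<subseteq> D \<and> D \<subset> I"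
  using bspec[OF assms(1)[unfolded is_split_def] assms(2)] by blast+

text \<open>The idea of the splitting: two points of \<open>I\<close> are equivalent if some member of \<open>\<B>\<close> properly
  inside \<open>I\<close> contains both. In each class fix a point \<open>p\<close> and one member \<open>A\<close> of \<open>\<B>\<close> around it;
  the class is partitioned into \<open>A\<close> and the sets \<open>K p x\<close>. Although \<open>K p x\<close> need not
  belong to \<open>\<B>\<close>, it lies inside every member of \<open>\<B>\<close> that contains both \<open>p\<close> and \<open>x\<close>.\<close>

lemma is_split_exists:
  assumes X: "Hausdorff_space X" and base: "base_of X \<B>" and nest: "nested \<B>"
    and I: "I \<subseteq> topspace X" "compatible \<B> I" "a \<in> I" "b \<in> I" "a \<noteq> b"
  obtains g where "is_split X \<B> I g"
proof -
  note sep = base_of_separation[OF X base]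
  \<comment> \<open>\<open>cl x\<close> is the equivalence class of \<open>x\<close>. The choices
    \<open>p x\<close> and \<open>A x\<close> depend on \<open>x\<close> only through
    \<open>cl x\<close>, so the whole class shares them.\<close>
  define cl where "cl x = \<Union>{C \<in> \<B>. x \<in> C \<and> C \<subset> I}" for x
  define p where "p x = (SOME q. q \<in> cl x)" for x
  define A where "A x = (SOME C. C \<in> \<B> \<and> p x \<in> C \<and> C \<subset> I)" for x
  define K where "K q x = \<Union>{C \<in> \<B>. x \<in> C \<and> q \<notin> C}" for q x
  define g where "g x = (if x \<in> A x then A x else K (p x) x)" for x
  \<comment> \<open>A member around \<open>x\<close> that misses a second point of \<open>I\<close>
    cannot contain \<open>I\<close>, so by compatibility it lies properly inside.\<close>
  have clI: "\<exists>C\<in>\<B>. x \<in> C \<and> C \<subset> I" if x: "x \<in> I" for x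
  proof -
    obtain y where y: "y \<in> I" "x \<noteq> y"
      using I(3-5) by blast
    then obtain C where "C \<in> \<B>" "x \<in> C" "y \<notin> C"
      using sep[of x y] x I(1) by blast
    then show ?thesis
      using compatibleD[OF I(2), of C x] x y by blast
  qed
  \<comment> \<open>Transitivity: of two members through \<open>y\<close>, the larger one contains
    both \<open>x\<close> and \<open>z\<close> and still lies properly inside
    \<open>I\<close>.\<close>
  have cl_sub: "cl y \<subseteq> cl x" if C: "C \<in> \<B>" "C \<subset> I" "x \<in> C" "y \<in> C" for x y C
  proof
    fix z assume "z \<in> cl y"
    then obtain D where D: "D \<in> \<B>" "y \<in> D" "D \<subset> I" "z \<in> D"
      by (auto simp: cl_def)
    then show "z \<in> cl x"
      using nestedD[OF nest C(1) D(1) C(4) D(2)] C unfolding cl_def by blast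
  qed
  have cl_eq: "cl y = cl x" if "y \<in> cl x" for x y
  proof -
    from that obtain C where "C \<in> \<B>" "C \<subset> I" "x \<in> C" "y \<in> C"
      by (auto simp: cl_def)
    then show ?thesis
      using cl_sub by blast
  qed
  have p_cl: "p x \<in> cl x" if x: "x \<in> I" for x
    unfolding p_def by (rule someI[of _ x]) (use clI[OF x] in \<open>auto simp: cl_def\<close>)
  have A: "A x \<in> \<B>" "p x \<in> A x" "A x \<subset> I" if x: "x \<in> I" for x
  proof -
    have "p x \<in> I"
      using p_cl[OF x] by (auto simp: cl_def)
    then have "\<exists>C. C \<in> \<B> \<and> p x \<in> C \<and> C \<subset> I"
      using clI by blast
    from someI_ex[OF this] show "A x \<in> \<B>" "p x \<in> A x" "A x \<subset> I"
      by (simp_all add: A_def)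
  qed
  have A_eq: "A y = A x" and p_eq: "p y = p x" if "y \<in> cl x" for x y
    using cl_eq[OF that] by (simp_all add: A_def p_def)
  \<comment> \<open>If \<open>E\<close> is not inside the member \<open>C\<close> of the union that
    it meets, it contains \<open>C\<close> and hence \<open>x\<close>. Then \<open>E\<close> is
    itself part of the union if it misses \<open>q\<close>; if it contains \<open>q\<close>, it
    contains every part.\<close>
  have K_compat: "compatible \<B> (K q x)" for q x
    unfolding compatible_def
  proof (intro ballI impI)
    fix E assume E: "E \<in> \<B>" "E \<inter> K q x \<noteq> {}"
    then obtain z C where C: "z \<in> E" "z \<in> C" "C \<in> \<B>" "x \<in> C" "q \<notin> C"
      by (auto simp: K_def)
    show "E \<subseteq> K q x \<or> K q x \<subseteq> E"
    proof (cases "E \<subseteq> C")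
      case True
      then show ?thesis
        using C by (auto simp: K_def)
    next
      case False
      then have xE: "x \<in> E"
        using nestedD[OF nest E(1) C(3) C(1,2)] C by blast
      show ?thesis
      proof (cases "q \<in> E")
        case True
        then show ?thesis
          using nestedD[OF nest E(1) _ xE] unfolding K_def by blast
      next
        case False
        then show ?thesis
          using E(1) xE by (auto simp: K_def)
      qed
    qed
  qed
  have K_eq: "K q y \<subseteq> K q x" if "C \<in> \<B>" "x \<in> C" "q \<notin> C" "y \<in> C" for q x y C
  proof
    fix z assume "z \<in> K q y"
    then obtain D where D: "D \<in> \<B>" "y \<in> D" "q \<notin> D" "z \<in> D"
      by (auto simp: K_def)
    then show "z \<in> K q x"
      using nestedD[OF nest that(1) D(1) that(4) D(2)] that unfolding K_def by blast
  qed
  have "is_split X \<B> I g"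
    unfolding is_split_def
  proof (intro ballI)
    fix x assume x: "x \<in> I"
    show "x \<in> g x \<and> (\<forall>y\<in>g x. g y = g x) \<and> openin X (g x) \<and>
     compatible \<B> (g x) \<and> (\<exists>D\<in>\<B>. g x \<subseteq> D \<and> D \<subset> I)"
    proof (cases "x \<in> A x")
      case True
      then have gx: "g x = A x"
        by (simp add: g_def)
      have "g y = g x" if y: "y \<in> A x" for y
      proof -
        have "y \<in> cl x"
          using A[OF x] True y unfolding cl_def by blast
        then show ?thesis
          using gx y A_eq by (simp add: g_def)
      qed
      then show ?thesis
        using gx True A[OF x] base nested_compatible[OF nest] unfolding base_of_def by auto
    next
      case False
      then have gx: "g x = K (p x) x"
        by (simp add: g_def)
      obtain D where D: "D \<in> \<B>" "x \<in> D" "D \<subset> I" "p x \<in> D"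
        using p_cl[OF x] by (auto simp: cl_def)
      \<comment> \<open>Since \<open>p x\<close> lies in \<open>D\<close> but not in
        \<open>C\<close>, only one of the two inclusions is possible at \<open>x\<close>. This
        bounds \<open>K (p x) x\<close> by \<open>D\<close>.\<close>
      have in_D: "C \<subseteq> D" if C: "C \<in> \<B>" "x \<in> C" "p x \<notin> C" for C
        using nestedD[OF nest C(1) D(1) C(2) D(2)] D(4) C(3) by blast
      have "p x \<noteq> x"
        using A[OF x] False by auto
      then obtain C where "C \<in> \<B>" "x \<in> C" "p x \<notin> C"
        using sep[of x "p x"] D I(1) by (metis psubset_imp_subset subsetD)
      then have "x \<in> K (p x) x"
        by (auto simp: K_def)
      moreover have "g y = g x" if y: "y \<in> K (p x) x" for y
      proof -
        obtain C where C: "C \<in> \<B>" "x \<in> C" "p x \<notin> C" "y \<in> C"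
          using y by (auto simp: K_def)
        then have "y \<in> cl x"
          using D in_D unfolding cl_def by blast
        \<comment> \<open>If \<open>A x\<close> met \<open>C\<close> in \<open>y\<close>, nestedness
          would put \<open>p x\<close> into \<open>C\<close> or \<open>x\<close> into
          \<open>A x\<close>.\<close>
        moreover have "y \<notin> A x"
          using nestedD[OF nest A(1)[OF x] C(1) _ C(4)] A(2)[OF x] C(2,3) False by blast
        ultimately have "g y = K (p x) y"
          using A_eq p_eq by (simp add: g_def)
        then show ?thesis
          using gx K_eq[OF C] K_eq[OF C(1,4,3,2)] by (simp add: subset_antisym)
      qed
      moreover have "openin X (K (p x) x)"
        using base unfolding K_def base_of_def by (intro openin_Union) blast
      moreover have "K (p x) x \<subseteq> D"
        using in_D by (auto simp: K_def)
      ultimately show ?thesis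
        using gx D K_compat by auto
    qed
  qed
  then show thesis
    using that by blast
qed

section \<open>Towers generated by a decreasing map\<close>

text \<open>As in the Bourbaki--Witt theorem, closure under \<open>f\<close> and intersections replaces
  transfinite iteration of \<open>f\<close>.\<close>

inductive_set tower :: "'a set \<Rightarrow> ('a set \<Rightarrow> 'a set) \<Rightarrow> 'a set set"
  for E :: "'a set" and f :: "'a set \<Rightarrow> 'a set" where
  tower_start: "E \<in> tower E f"
| tower_step: "I \<in> tower E f \<Longrightarrow> f I \<in> tower E f"
| tower_Inter: "\<M> \<noteq> {} \<Longrightarrow> (\<And>I. I \<in> \<M> \<Longrightarrow> I \<in> tower E f) \<Longrightarrow> \<Inter>\<M> \<in> tower E f"

lemma tower_subset:
  assumes "\<And>I. f I \<subseteq> I" "I \<in> tower E f"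
  shows "I \<subseteq> E"
  using assms(2) by induction (use assms(1) in blast)+

text \<open>A double induction: \<open>cmp\<close> treats a member \<open>c\<close> for which every
  properly larger \<open>J\<close> satisfies \<open>c \<subseteq> f J\<close>, and the second
  induction shows that all members are of this kind.\<close>

lemma tower_comparable_step:
  assumes f: "\<And>I. f I \<subseteq> I" and I: "I \<in> tower E f" and J: "J \<in> tower E f"
  shows "I \<subseteq> J \<or> J \<subseteq> f I"
proof -
  have cmp: "c \<subseteq> J \<or> J \<subseteq> f c"
    if c: "\<And>J. J \<in> tower E f \<Longrightarrow> c \<subset> J \<Longrightarrow> c \<subseteq> f J" "c \<in> tower E f" and J: "J \<in> tower E f" for c J
    using J
  proof induction
    case tower_start
    then show ?case
      using tower_subset[OF f c(2)] by blast
  next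
    case (tower_step J)
    then show ?case
      using c(1)[of J] f[of J] by blast
  next
    case (tower_Inter \<M>)
    then show ?case
      by blast
  qed
  have "c \<subset> J \<Longrightarrow> c \<subseteq> f J" if "c \<in> tower E f" "J \<in> tower E f" for c J
    using that
  proof (induction arbitrary: J)
    case tower_start
    then show ?case
      using tower_subset[OF f] by blast
  next
    case (tower_step c)
    then show ?case
      using cmp[of c J] f[of c] by blast
  next
    case (tower_Inter \<M>)
    \<comment> \<open>A single \<open>m\<close> that does not contain \<open>J\<close> already lies
      properly inside \<open>J\<close>, hence inside \<open>f J\<close> by the induction
      hypothesis.\<close>
    then obtain m where m: "m \<in> \<M>" "\<not> J \<subseteq> m"
      by blast
    then have "m \<subset> J"
      using cmp[of m J] tower_Inter f[of m] by blast
    then show ?case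
      using m tower_Inter by blast
  qed
  then show ?thesis
    using cmp[of I J] I J by blast
qed

text \<open>Let \<open>I\<close> be the least tower member containing all of \<open>\<S>\<close>. If
  \<open>I \<notin> \<S>\<close>, all of \<open>\<S>\<close> lies in \<open>f I\<close>, so
  \<open>I\<close> is a fixed point; but a fixed point is the least member of the tower, which
  forces \<open>\<S>\<close> to consist of \<open>I\<close>.\<close>

lemma tower_has_largest:
  assumes f: "\<And>I. f I \<subseteq> I" and S: "\<S> \<subseteq> tower E f" "\<S> \<noteq> {}"
  obtains M where "M \<in> \<S>" "\<And>J. J \<in> \<S> \<Longrightarrow> J \<subseteq> M"
proof -
  define U where "U = {I \<in> tower E f. \<forall>J\<in>\<S>. J \<subseteq> I}"
  define I where "I = \<Inter>U"
  have "E \<in> U"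
    using S tower_subset[OF f] tower_start unfolding U_def by blast
  then have I: "I \<in> tower E f"
    unfolding I_def by (intro tower_Inter) (auto simp: U_def)
  have SI: "J \<subseteq> I" if "J \<in> \<S>" for J
    using that unfolding I_def U_def by blast
  have least: "I \<subseteq> I'" if "I' \<in> tower E f" "\<And>J. J \<in> \<S> \<Longrightarrow> J \<subseteq> I'" for I'
    using that unfolding I_def U_def by blast
  have "I \<in> \<S>"
  proof (rule ccontr)
    assume notin: "I \<notin> \<S>"
    have "J \<subseteq> f I" if J: "J \<in> \<S>" for J
      using tower_comparable_step[OF f I, of J] S(1) SI[OF J] J notin by (metis subset_antisym subsetD)
    then have "I \<subseteq> f I"
      using tower_step[OF I] least by blast
    then have fI: "f I = I"
      using f[of I] by (rule subset_antisym[rotated])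
    \<comment> \<open>The generation of the tower cannot get past a fixed point: a step from
      \<open>J\<close> goes below \<open>I\<close> only if \<open>J = I\<close>, and then it stays
      at \<open>I\<close>.\<close>
    have "I \<subseteq> J" if "J \<in> tower E f" for J
      using that
    proof induction
      case tower_start
      then show ?case
        using tower_subset[OF f I] .
    next
      case (tower_step J)
      then show ?case
        using tower_comparable_step[OF f _ I, of J] fI by (metis subset_antisym)
    next
      case (tower_Inter \<M>)
      then show ?case
        by blast
    qed
    then show False
      using S SI notin by (metis ex_in_conv subset_antisym subsetD)
  qed
  then show thesis
    using that SI by blast
qed

section \<open>From a nested base to a tree base\<close>

text \<open>The last clause says that reverse inclusion is well-founded above each member. In a
  nonempty space \<open>{}\<close> is excluded, as every other member would be its
  predecessor.\<close>

definition tree_base :: "'a topology \<Rightarrow> 'a set set \<Rightarrow> bool" where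
  "tree_base X \<N> \<longleftrightarrow> base_of X \<N> \<and> nested \<N> \<and> topspace X \<in> \<N> \<and> ({} \<in> \<N> \<longrightarrow> topspace X = {}) \<and>
     (\<forall>t\<in>\<N>. \<forall>\<S>\<subseteq>\<N>. \<S> \<noteq> {} \<and> (\<forall>s\<in>\<S>. t \<subseteq> s) \<longrightarrow> (\<exists>m\<in>\<S>. \<forall>s\<in>\<S>. s \<subseteq> m))"

lemma tree_base_subset: "tree_base X \<N> \<Longrightarrow> V \<in> \<N> \<Longrightarrow> V \<subseteq> topspace X"
  by (simp add: tree_base_def base_of_def openin_subset)

text \<open>A least member of a centered \<open>\<C>\<close> is its intersection. Without one, the
  larger sets \<open>D V\<close> have a common point \<open>y\<close>, and every
  \<open>W \<in> \<C>\<close> contains some \<open>D V\<close> with \<open>V \<in> \<C>\<close>,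
  hence \<open>y\<close>.\<close>

lemma complete_family_interleaved:
  assumes compl: "complete_family X \<B>" and nest: "nested \<N>" and ne: "{} \<notin> \<N>"
    and sub: "\<And>V. V \<in> \<N> \<Longrightarrow> V \<subseteq> topspace X"
    and D: "\<And>V. V \<in> \<N> \<Longrightarrow> V \<noteq> topspace X \<Longrightarrow> D V \<in> \<B> \<and> V \<subseteq> D V"
      "\<And>V W. V \<in> \<N> \<Longrightarrow> W \<in> \<N> \<Longrightarrow> V \<subset> W \<Longrightarrow> D V \<subseteq> W"
  shows "complete_family X \<N>"
  unfolding complete_family_def
proof (intro allI impI, elim conjE)
  fix \<C> assume C: "\<C> \<subseteq> \<N>" "centered \<C>"
  show "topspace X \<inter> \<Inter>\<C> \<noteq> {}"
  proof (cases "\<exists>V\<in>\<C>. \<forall>W\<in>\<C>. V \<subseteq> W")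
    case True
    then obtain V where "V \<in> \<C>" "V \<subseteq> \<Inter>\<C>"
      by blast
    moreover have "V \<subseteq> topspace X" "V \<noteq> {}"
      using C(1) \<open>V \<in> \<C>\<close> sub ne by blast+
    ultimately show ?thesis
      by blast
  next
    case False
    \<comment> \<open>No set \<open>D\<close> is provided for the whole space, and dropping it does
      not change intersections taken inside the space.\<close>
    let ?C = "\<C> - {topspace X}"
    have "centered (D ` ?C)"
      unfolding centered_def
    proof (intro allI impI, elim conjE)
      fix \<F> assume F: "\<F> \<subseteq> D ` ?C" "finite \<F>" "\<F> \<noteq> {}"
      obtain \<G> where G: "\<G> \<subseteq> ?C" "finite \<G>" "\<F> = D ` \<G>"
        using finite_subset_image[OF F(2,1)] by blast
      have "\<Inter>\<G> \<noteq> {}"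
        using C(2) G F(3) unfolding centered_def by blast
      moreover have "\<Inter>\<G> \<subseteq> \<Inter>\<F>"
        using G C(1) D(1) by blast
      ultimately show "\<Inter>\<F> \<noteq> {}"
        by blast
    qed
    moreover have "D ` ?C \<subseteq> \<B>"
      using C(1) D(1) by blast
    ultimately have "topspace X \<inter> \<Inter>(D ` ?C) \<noteq> {}"
      using compl unfolding complete_family_def by simp
    then obtain y where y: "y \<in> topspace X" "\<And>V. V \<in> ?C \<Longrightarrow> y \<in> D V"
      by auto
    have "y \<in> W" if W: "W \<in> \<C>" for W
    proof -
      obtain V where V: "V \<in> \<C>" "\<not> W \<subseteq> V"
        using False W by blast
      then have "V \<subset> W"
        using centered_inter[OF C(2) V(1) W] nest C(1) W unfolding nested_def by blast
      moreover have "V \<noteq> topspace X"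
        using V W C(1) sub by blast
      ultimately show ?thesis
        using D(2)[of V W] y(2)[of V] V(1) W C(1) by blast
    qed
    then show ?thesis
      using y(1) by blast
  qed
qed

text \<open>For \<open>V \<subset> W\<close> one has \<open>D V \<subset> W \<subseteq> D W\<close>,
  so if \<open>V\<close> is nonempty, \<open>D V\<close> and \<open>D W\<close> are distinct and
  meet. Sorting the members by the disjoint family containing \<open>D V\<close> therefore separates
  nested ones.\<close>

lemma sigma_disjoint_interleaved:
  assumes sig: "sigma_disjoint \<B>" and nest: "nested \<N>" and R: "R \<in> \<N>"
    and D: "\<And>V. V \<in> \<N> \<Longrightarrow> V \<noteq> R \<Longrightarrow> D V \<in> \<B> \<and> V \<subseteq> D V"
      "\<And>V W. V \<in> \<N> \<Longrightarrow> W \<in> \<N> \<Longrightarrow> V \<subset> W \<Longrightarrow> D V \<subset> W"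
  shows "sigma_disjoint \<N>"
proof -
  obtain \<D> :: "nat \<Rightarrow> 'a set set" where \<D>: "\<And>n. disjoint (\<D> n)" "\<B> = (\<Union>n. \<D> n)"
    using sig by (auto simp: sigma_disjoint_def)
  \<comment> \<open>Index 0 is reserved for \<open>R\<close>, which has no \<open>D\<close>; the
    other indices are shifted by one.\<close>
  define \<E> where "\<E> n = (case n of 0 \<Rightarrow> {R} | Suc n \<Rightarrow> {V \<in> \<N> - {R}. D V \<in> \<D> n})" for n
  have False if V: "V \<in> \<N> - {R}" "D V \<in> \<D> n" "W \<in> \<N> - {R}" "D W \<in> \<D> n" "V \<subset> W" "V \<noteq> {}" for V W n
  proof -
    have "D V \<subset> D W" "D V \<inter> D W \<noteq> {}"
      using D(1)[of V] D(1)[of W] D(2)[of V W] V by blast+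
    then show False
      using \<D>(1)[of n] V(2,4) by (auto simp: disjoint_def)
  qed
  then have "V \<inter> W = {}" if "V \<in> \<E> n" "W \<in> \<E> n" "V \<noteq> W" for V W n
    using that nest unfolding nested_def \<E>_def by (cases n) (simp, simp, metis inf_bot_left inf_bot_right psubsetI)
  then have "disjoint (\<E> n)" for n
    by (auto simp: disjoint_def)
  moreover have "\<E> n \<subseteq> \<N>" for n
    using R by (cases n) (auto simp: \<E>_def)
  then have "\<N> = (\<Union>n. \<E> n)"
  proof (intro equalityI subsetI)
    fix V assume V: "V \<in> \<N>"
    show "V \<in> (\<Union>n. \<E> n)"
    proof (cases "V = R")
      case True
      then have "V \<in> \<E> 0"
        by (simp add: \<E>_def)
      then show ?thesis by blast
    next
      case False
      then obtain n where "D V \<in> \<D> n"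
        using D(1)[OF V] \<D>(2) by blast
      then have "V \<in> \<E> (Suc n)"
        using False V by (simp add: \<E>_def)
      then show ?thesis by blast
    qed
  qed blast
  ultimately show ?thesis
    unfolding sigma_disjoint_def by blast
qed

text \<open>Each point \<open>x\<close> has its own tower \<open>F x\<close> of regions around it. A
  region belongs to the towers of all its points, which makes the towers fit together into a
  tree.\<close>

lemma tree_base_exists:
  assumes X: "Hausdorff_space X" and base: "base_of X \<B>" and nest: "nested \<B>"
  obtains \<N> where "tree_base X \<N>"
    "sigma_disjoint \<B> \<Longrightarrow> sigma_disjoint \<N>"
    "complete_family X \<B> \<Longrightarrow> complete_family X \<N>"
proof -
  define two where "two I \<longleftrightarrow> (\<exists>a\<in>I. \<exists>b\<in>I. a \<noteq> b)" for I :: "'a set"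
  define sp where "sp I = (SOME g. is_split X \<B> I g)" for I
  \<comment> \<open>The split \<open>sp I\<close> is chosen per region, not per point. Intersecting
    with \<open>I\<close> makes \<open>f x\<close> decreasing on arbitrary sets; on regions it
    changes nothing (\<open>f_eq\<close>).\<close>
  define f where "f x I = (if two I then sp I x \<inter> I else I)" for x I
  define F where "F x = tower (topspace X) (f x)" for x
  have f_sub: "f x I \<subseteq> I" for x I
    by (auto simp: f_def)
  have sp: "is_split X \<B> I (sp I)" if "I \<subseteq> topspace X" "compatible \<B> I" "two I" for I
  proof -
    obtain a b where "a \<in> I" "b \<in> I" "a \<noteq> b"
      using \<open>two I\<close> unfolding two_def by blast
    from is_split_exists[OF X base nest that(1,2) this] have "\<exists>g. is_split X \<B> I g"
      by metis
    then show ?thesis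
      unfolding sp_def by (rule someI_ex)
  qed
  have f_eq: "f x I = sp I x" if "I \<subseteq> topspace X" "compatible \<B> I" "two I" "x \<in> I" for x I
  proof -
    have "sp I x \<subseteq> I"
      using is_splitD(5)[OF sp[OF that(1-3)] that(4)] by blast
    then show ?thesis
      using that(3) by (simp add: f_def Int_absorb2)
  qed
  have inv: "x \<in> I \<and> I \<subseteq> topspace X \<and> compatible \<B> I" if x: "x \<in> topspace X" and I: "I \<in> F x" for x I
    using I unfolding F_def
  proof induction
    case tower_start
    have "compatible \<B> (topspace X)"
      using base openin_subset unfolding base_of_def compatible_def by blast
    then show ?case
      using x by blast
  next
    case (tower_step I)
    show ?case
    proof (cases "two I")
      case True
      have I: "x \<in> I" "I \<subseteq> topspace X" "compatible \<B> I"
        using tower_step by auto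
      show ?thesis
        using is_splitD(1,4)[OF sp[OF I(2,3) True] I(1), folded f_eq[OF I(2,3) True I(1)]]
          f_sub[of x I] I(2) by simp
    next
      case False
      then show ?thesis
        using tower_step by (simp add: f_def)
    qed
  next
    case (tower_Inter \<M>)
    then have "compatible \<B> (\<Inter>\<M>)"
      by (intro compatible_Inter) blast
    then show ?case
      using tower_Inter by blast
  qed
  \<comment> \<open>As long as \<open>y\<close> stays in the cell of \<open>x\<close>, both points
    have the same cell, so their towers take the same step.\<close>
  have transfer: "I \<in> F y" if x: "x \<in> topspace X" and I: "I \<in> F x" and y: "y \<in> I" for x y I
    using I[unfolded F_def] y
  proof induction
    case tower_start
    then show ?case
      by (simp add: F_def tower.tower_start)
  next
    case (tower_step I)
    then have I: "I \<in> F y" "x \<in> I" "I \<subseteq> topspace X" "compatible \<B> I" "y \<in> I"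
      using f_sub[of x I] inv[OF x, of I] by (auto simp: F_def)
    have "f y I = f x I"
    proof (cases "two I")
      case True
      then have "y \<in> sp I x"
        using f_eq[OF I(3,4) True I(2)] tower_step.prems by simp
      then show ?thesis
        using f_eq[OF I(3,4) True I(2)] f_eq[OF I(3,4) True I(5)] is_splitD(2)[OF sp[OF I(3,4) True] I(2)]
        by simp
    qed (simp add: f_def)
    then show ?case
      using I(1) tower.tower_step[of I _ "f y"] by (simp add: F_def)
  next
    case (tower_Inter \<M>)
    then show ?case
      unfolding F_def by (intro tower.tower_Inter) auto
  qed
  \<comment> \<open>Both regions belong to the tower of the common point \<open>z\<close>, which is
    a chain.\<close>
  have cmp: "I \<subseteq> J \<or> J \<subseteq> I" if "x \<in> topspace X" "I \<in> F x" "y \<in> topspace X" "J \<in> F y" "z \<in> I" "z \<in> J" for x y z I J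
    using tower_comparable_step[of "f z" I "topspace X" J, OF f_sub] transfer[of x I z] transfer[of y J z] f_sub[of z I]
      that unfolding F_def by blast
  have top: "topspace X \<in> F x" for x
    by (simp add: F_def tower_start)

  \<comment> \<open>The set \<open>D\<close> separates \<open>V\<close> from all larger regions; this discards the regions that arise only
    as proper intersections.\<close>
  define \<N> where "\<N> = insert (topspace X) {V. \<exists>x\<in>topspace X. V \<in> F x \<and> openin X V \<and>
     (\<exists>D\<in>\<B>. V \<subseteq> D \<and> (\<forall>y\<in>topspace X. \<forall>W\<in>F y. V \<subset> W \<longrightarrow> D \<subset> W))}"
  have \<N>_cases: "V = topspace X \<or> (\<exists>x\<in>topspace X. V \<in> F x)" if "V \<in> \<N>" for V
    using that by (auto simp: \<N>_def)
  have \<N>_sub: "V \<subseteq> topspace X" if "V \<in> \<N>" for V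
    using \<N>_cases[OF that] inv by blast
  have \<N>_F: "V \<in> F x" if "V \<in> \<N>" "x \<in> V" for V x
    using \<N>_cases[OF that(1)] top transfer that(2) by blast
  have \<N>_empty: "topspace X = {}" if "{} \<in> \<N>"
    using \<N>_cases[OF that] inv by blast
  have \<N>_base: "base_of X \<N>"
    unfolding base_of_def
  proof (intro conjI ballI allI impI)
    show "openin X V" if "V \<in> \<N>" for V
      using that by (auto simp: \<N>_def)
    fix U x assume U: "openin X U \<and> x \<in> U"
    then have x: "x \<in> topspace X"
      using openin_subset by blast
    obtain C where C: "C \<in> \<B>" "x \<in> C" "C \<subseteq> U"
      using base U unfolding base_of_def by meson
    have oC: "openin X C"
      using base C unfolding base_of_def by blast
    \<comment> \<open>\<open>I\<close> is the last region around \<open>x\<close> that contains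
      \<open>C\<close>. If it has two points, its cell \<open>V\<close> around \<open>x\<close> no
      longer contains \<open>C\<close>, so \<open>V \<subseteq> C\<close> by compatibility;
      otherwise \<open>I = C\<close>.\<close>
    define I where "I = \<Inter>{J \<in> F x. C \<subseteq> J}"
    have I: "I \<in> F x"
      unfolding I_def F_def
      by (rule tower_Inter) (use top[of x] openin_subset[OF oC] in \<open>auto simp: F_def\<close>)
    have CI: "C \<subseteq> I"
      by (auto simp: I_def)
    have least: "I \<subseteq> J" if "J \<in> F x" "C \<subseteq> J" for J
      using that by (auto simp: I_def)
    have "\<exists>V\<in>\<N>. x \<in> V \<and> V \<subseteq> C"
    proof (cases "two I")
      case True
      have I': "x \<in> I" "I \<subseteq> topspace X" "compatible \<B> I"
        using inv[OF x I] by auto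
      define V where "V = f x I"
      have V_eq: "V = sp I x"
        using f_eq[OF I'(2,3) True I'(1)] by (simp add: V_def)
      note s = is_splitD[OF sp[OF I'(2,3) True] I'(1), folded V_eq]
      have V: "V \<in> F x"
        using tower_step[of I _ "f x"] I by (simp add: F_def V_def)
      obtain D where D: "D \<in> \<B>" "V \<subseteq> D" "D \<subset> I"
        using s(5) by blast
      have "\<not> C \<subseteq> V"
        using least[OF V] D by blast
      then have "V \<subseteq> C"
        using compatibleD[OF s(4) C(1,2) s(1)] by blast
      \<comment> \<open>No region lies strictly between \<open>V\<close> and \<open>I\<close>, so a
        \<open>W\<close> larger than \<open>V\<close> contains \<open>I\<close>, and the split gave
        \<open>D \<subset> I\<close>.\<close>
      moreover have "D \<subset> W" if W: "y \<in> topspace X" "W \<in> F y" "V \<subset> W" for y W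
      proof -
        have "x \<in> W"
          using s(1) W(3) by blast
        then have "W \<in> F x"
          using transfer W by blast
        then have "I \<subseteq> W"
          using tower_comparable_step[of "f x" I "topspace X" W, OF f_sub] I W(3) unfolding F_def V_def by blast
        then show ?thesis
          using D by blast
      qed
      then have "V \<in> \<N>"
        unfolding \<N>_def using x V s(3) D(1,2)
        by (intro insertI2 CollectI bexI[of _ x] bexI[of _ D] conjI ballI impI)
      ultimately show ?thesis
        using s(1) by blast
    next
      case False
      then have "I = C"
        using C(2) CI unfolding two_def by (metis subsetD subsetI subset_antisym)
      then have "C \<in> \<N>"
        unfolding \<N>_def using x I oC C(1)
        by (intro insertI2 CollectI bexI[of _ x] bexI[of _ C] conjI ballI impI) auto
      then show ?thesis
        using C(2) by blast
    qed
    then show "\<exists>V\<in>\<N>. x \<in> V \<and> V \<subseteq> U"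
      using C(3) by blast
  qed
  have \<N>_nested: "nested \<N>"
    unfolding nested_def
  proof (intro ballI impI)
    fix A B assume AB: "A \<in> \<N>" "B \<in> \<N>" "A \<inter> B \<noteq> {}"
    then obtain z where "z \<in> A" "z \<in> B"
      by blast
    then show "A \<subseteq> B \<or> B \<subseteq> A"
      using cmp[of z A z B z] \<N>_F AB \<N>_sub by blast
  qed
  have largest: "\<exists>m\<in>\<S>. \<forall>s\<in>\<S>. s \<subseteq> m" if S: "t \<in> \<N>" "\<S> \<subseteq> \<N>" "\<S> \<noteq> {}" "\<forall>s\<in>\<S>. t \<subseteq> s" for t \<S>
  proof (cases "t = {}")
    case True
    then have "s = {}" if "s \<in> \<S>" for s
      using \<N>_empty \<N>_sub S that by blast
    then show ?thesis
      using S(3) by blast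
  next
    case False
    then obtain x where x: "x \<in> t"
      by blast
    then have "\<S> \<subseteq> tower (topspace X) (f x)"
      using S \<N>_F unfolding F_def by blast
    then obtain M where "M \<in> \<S>" "\<And>J. J \<in> \<S> \<Longrightarrow> J \<subseteq> M"
      using tower_has_largest[of "f x", OF f_sub _ S(3)] by metis
    then show ?thesis
      by blast
  qed
  have topN: "topspace X \<in> \<N>"
    by (simp add: \<N>_def)
  have tb: "tree_base X \<N>"
    unfolding tree_base_def
    by (intro conjI ballI allI impI; (elim conjE)?)
      (fact \<N>_base \<N>_nested topN \<N>_empty | erule (3) largest)+
  have "\<exists>D. V \<in> \<N> \<longrightarrow> V \<noteq> topspace X \<longrightarrow> D \<in> \<B> \<and> V \<subseteq> D \<and> (\<forall>W\<in>\<N>. V \<subset> W \<longrightarrow> D \<subset> W)" for V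
  proof (cases "V \<in> \<N> \<and> V \<noteq> topspace X")
    case True
    then obtain x where x: "x \<in> topspace X" "V \<in> F x"
      and "\<exists>D\<in>\<B>. V \<subseteq> D \<and> (\<forall>y\<in>topspace X. \<forall>W\<in>F y. V \<subset> W \<longrightarrow> D \<subset> W)"
      by (auto simp only: \<N>_def insert_iff mem_Collect_eq)
    then obtain D where D: "D \<in> \<B>" "V \<subseteq> D" "\<forall>y\<in>topspace X. \<forall>W\<in>F y. V \<subset> W \<longrightarrow> D \<subset> W"
      by (elim bexE conjE)
    have "W \<in> F x" if "W \<in> \<N>" "V \<subset> W" for W
      using \<N>_F[OF that(1), of x] that(2) inv[OF x] by blast
    then have "\<forall>W\<in>\<N>. V \<subset> W \<longrightarrow> D \<subset> W"
      using D(3) x(1) by simp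
    then show ?thesis
      using D(1,2) by blast
  qed blast
  then obtain D where D: "\<And>V. V \<in> \<N> \<Longrightarrow> V \<noteq> topspace X \<Longrightarrow> D V \<in> \<B> \<and> V \<subseteq> D V"
    "\<And>V W. V \<in> \<N> \<Longrightarrow> V \<noteq> topspace X \<Longrightarrow> W \<in> \<N> \<Longrightarrow> V \<subset> W \<Longrightarrow> D V \<subset> W"
    by metis
  have D2: "D V \<subset> W" if "V \<in> \<N>" "W \<in> \<N>" "V \<subset> W" for V W
    using D(2)[of V W] \<N>_sub that by blast
  show thesis
  proof (rule that[OF tb])
    show "sigma_disjoint \<N>" if "sigma_disjoint \<B>"
      using sigma_disjoint_interleaved[OF that \<N>_nested topN D(1) D2] .
    show "complete_family X \<N>" if compl: "complete_family X \<B>"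
    proof (rule complete_family_interleaved[OF compl \<N>_nested _ \<N>_sub D(1)])
      \<comment> \<open>The empty subfamily is centered, so completeness yields a point of the
        space.\<close>
      have "topspace X \<noteq> {}"
        using compl unfolding complete_family_def centered_def
        by (metis empty_subsetI inf_bot_left subset_empty)
      then show "{} \<notin> \<N>"
        using \<N>_empty by blast
    qed (use D2 in auto)
  qed
qed

section \<open>The tree of a tree base\<close>

definition reverse_inclusion :: "'a set set \<Rightarrow> 'a set rel" where
  "reverse_inclusion \<N> = {(V, W). V \<in> \<N> \<and> W \<in> \<N> \<and> W \<subseteq> V}"

lemma in_reverse_inclusion [simp]:
  "(V, W) \<in> reverse_inclusion \<N> \<longleftrightarrow> V \<in> \<N> \<and> W \<in> \<N> \<and> W \<subseteq> V"
  by (simp add: reverse_inclusion_def)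

lemma Field_reverse_inclusion [simp]: "Field (reverse_inclusion \<N>) = \<N>"
  by (auto simp: Field_def)

text \<open>The predecessors of a nonempty \<open>t\<close> meet in \<open>t\<close>, so nestedness
  makes them a chain; the largest member of a set of predecessors is its minimal node.\<close>

lemma tree_reverse_inclusion:
  assumes tb: "tree_base X \<N>"
  shows "tree (reverse_inclusion \<N>)"
  unfolding tree_def
proof (intro conjI ballI)
  let ?T = "reverse_inclusion \<N>"
  show "Partial_order ?T"
    unfolding order_on_defs refl_on_def trans_def antisym_def
    by auto
  have top: "topspace X \<in> \<N>" "\<And>V. V \<in> \<N> \<Longrightarrow> V \<subseteq> topspace X"
    using tb tree_base_subset[OF tb] by (auto simp: tree_base_def)
  show "\<exists>!m. m \<in> Field ?T \<and> (\<forall>s. (s, m) \<in> ?T \<longrightarrow> s = m)"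
  proof (rule ex1I[of _ "topspace X"])
    show "m = topspace X" if "m \<in> Field ?T \<and> (\<forall>s. (s, m) \<in> ?T \<longrightarrow> s = m)" for m
      using that top(1) top(2)[of m] by auto
  qed (use top in auto)
  fix t assume t: "t \<in> Field ?T"
  let ?U = "underS ?T t"
  have comp: "V \<subseteq> W \<or> W \<subseteq> V" if "V \<in> ?U" "W \<in> ?U" for V W
  proof (cases "t = {}")
    case True
    then have "topspace X = {}"
      using tb t by (simp add: tree_base_def)
    then show ?thesis
      using top(2) that by (auto simp: underS_def)
  next
    case False
    then have "V \<in> \<N>" "W \<in> \<N>" "V \<inter> W \<noteq> {}"
      using that by (auto simp: underS_def)
    then show ?thesis
      using tb unfolding tree_base_def nested_def by blast
  qed
  have wf: "wf (Restr ?T ?U - Id)"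
    unfolding wf_eq_minimal
  proof (intro allI impI)
    fix Q x assume x: "x \<in> (Q :: 'a set set)"
    show "\<exists>z\<in>Q. \<forall>y. (y, z) \<in> Restr ?T ?U - Id \<longrightarrow> y \<notin> Q"
    proof (cases "Q \<inter> ?U = {}")
      case True
      then show ?thesis
        using x by blast
    next
      case False
      then obtain m where "m \<in> Q \<inter> ?U" "\<forall>s\<in>Q \<inter> ?U. s \<subseteq> m"
        using tb t unfolding tree_base_def
        by (elim conjE ballE[of _ _ t] allE[of _ "Q \<inter> ?U"]) (auto simp: underS_def)
      then show ?thesis
        by (intro bexI[of _ m]) auto
    qed
  qed
  show "well_order_on ?U (Restr ?T ?U)"
    unfolding well_order_on_def linear_order_on_def partial_order_on_def preorder_on_def
  proof (intro conjI wf)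
    show "refl_on ?U (Restr ?T ?U)"
      by (auto simp: refl_on_def underS_def)
    show "trans (Restr ?T ?U)"
      unfolding trans_def by (simp; blast)
    show "antisym (Restr ?T ?U)"
      unfolding antisym_def by (simp; blast)
    show "total_on ?U (Restr ?T ?U)"
      using comp by (auto simp: total_on_def underS_def)
  qed (auto simp: underS_def)
qed

text \<open>Comparable nonempty sets meet, so a disjoint family is an antichain; \<open>{}\<close>
  occurs only in the empty space.\<close>

lemma special_reverse_inclusion:
  assumes tb: "tree_base X \<N>" and "sigma_disjoint \<N>"
  shows "special (reverse_inclusion \<N>)"
proof -
  obtain \<D> :: "nat \<Rightarrow> 'a set set" where \<D>: "\<And>n. disjoint (\<D> n)" "\<N> = (\<Union>n. \<D> n)"
    using assms(2) by (auto simp: sigma_disjoint_def)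
  have sub: "V \<subseteq> topspace X" if "V \<in> \<N>" for V
    using tree_base_subset[OF tb that] .
  have "s = t" if st: "s \<in> \<D> n" "t \<in> \<D> n" "t \<subseteq> s" for s t n
  proof (cases "t = {}")
    case True
    then have "topspace X = {}"
      using tb st \<D>(2) unfolding tree_base_def by blast
    then show ?thesis
      using True sub[of s] st(1) \<D>(2) by blast
  next
    case False
    then show ?thesis
      using \<D>(1)[of n] st unfolding disjoint_def by blast
  qed
  then have "antichain (reverse_inclusion \<N>) (\<D> n)" for n
    using \<D>(2) by (auto simp: antichain_def)
  then show ?thesis
    unfolding special_def using \<D>(2) by auto
qed

text \<open>A nonempty \<open>V\<close> without \<open>x\<close> contains some
  \<open>y \<noteq> x\<close>; a member around \<open>x\<close> that misses \<open>y\<close> is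
  incomparable with \<open>V\<close>, so no path extends the family by \<open>V\<close>.\<close>

lemma branch_of_point:
  assumes X: "Hausdorff_space X" and tb: "tree_base X \<N>" and x: "x \<in> topspace X"
  shows "branch (reverse_inclusion \<N>) {V \<in> \<N>. x \<in> V}"
  unfolding branch_def
proof (intro conjI allI impI)
  let ?T = "reverse_inclusion \<N>"
  let ?b = "{V \<in> \<N>. x \<in> V}"
  have nest: "nested \<N>" and base: "base_of X \<N>" and ne: "{} \<notin> \<N>"
    using tb x by (auto simp: tree_base_def)
  show "tree_path ?T ?b"
    using nestedD[OF nest] by (auto simp: tree_path_def Chains_def under_def)
  fix P assume P: "tree_path ?T P \<and> ?b \<subseteq> P"
  have "x \<in> V" if V: "V \<in> P" for V
  proof (rule ccontr)
    assume "x \<notin> V"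
    have "V \<in> \<N>"
      using P V by (auto simp: tree_path_def)
    then obtain y where y: "y \<in> V" "y \<in> topspace X" "x \<noteq> y"
      using ne \<open>x \<notin> V\<close> base openin_subset unfolding base_of_def by (metis equals0I subsetD)
    then obtain C where C: "C \<in> \<N>" "x \<in> C" "y \<notin> C"
      using base_of_separation[OF X base x] by metis
    then have "C \<in> P" "P \<in> Chains ?T"
      using P by (auto simp: tree_path_def)
    then have "C \<subseteq> V \<or> V \<subseteq> C"
      using V by (simp add: Chains_def) blast
    then show False
      using C y \<open>x \<notin> V\<close> by blast
  qed
  then show "P = ?b"
    using P by (auto simp: tree_path_def)
qed

text \<open>The standard base of the branch space pulls back to \<open>\<N>\<close> itself, which
  gives continuity and openness onto the image; injectivity is separation of points.\<close>

lemma embedding_into_branch_space: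
  assumes X: "Hausdorff_space X" and tb: "tree_base X \<N>"
  shows "embedding_map X (branch_space (reverse_inclusion \<N>)) (\<lambda>x. \<lambda>V\<in>\<N>. x \<in> V)"
proof -
  let ?Y = "branch_space (reverse_inclusion \<N>)"
  let ?f = "\<lambda>x. \<lambda>V\<in>\<N>. x \<in> V"
  have base: "base_of X \<N>"
    using tb by (simp add: tree_base_def)
  have op: "openin X V" if "V \<in> \<N>" for V
    using base that by (simp add: base_of_def)
  have fY: "?f x \<in> topspace ?Y" if x: "x \<in> topspace X" for x
  proof -
    have "?f x = (\<lambda>V\<in>\<N>. V \<in> {V \<in> \<N>. x \<in> V})"
      by (auto simp: restrict_def)
    then show ?thesis
      using branch_of_point[OF X tb x] unfolding topspace_branch_space Field_reverse_inclusion by blast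
  qed
  have bY: "base_of ?Y ((\<lambda>V. {\<phi> \<in> topspace ?Y. \<phi> V}) ` \<N>)"
    using base_of_branch_space[OF tree_reverse_inclusion[OF tb]] by simp
  have cont: "continuous_map X ?Y ?f"
    unfolding continuous_map_def
  proof (intro conjI allI impI)
    fix U assume U: "openin ?Y U"
    have "\<exists>V. openin X V \<and> x \<in> V \<and> V \<subseteq> {x \<in> topspace X. ?f x \<in> U}"
      if x: "x \<in> topspace X" "?f x \<in> U" for x
    proof -
      obtain B where B: "B \<in> (\<lambda>V. {\<phi> \<in> topspace ?Y. \<phi> V}) ` \<N>" "?f x \<in> B" "B \<subseteq> U"
        using bY U x(2) unfolding base_of_def by meson
      then obtain V where V: "V \<in> \<N>" "?f x V" "{\<phi> \<in> topspace ?Y. \<phi> V} \<subseteq> U"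
        by auto
      have "?f z \<in> U" "z \<in> topspace X" if z: "z \<in> V" for z
      proof -
        show "z \<in> topspace X"
          using openin_subset[OF op[OF V(1)]] z by blast
        then show "?f z \<in> U"
          using V z fY[of z] by auto
      qed
      then show ?thesis
        using V(1,2) op[OF V(1)] by auto
    qed
    then show "openin X {x \<in> topspace X. ?f x \<in> U}"
      by (subst openin_subopen) blast
  qed (use fY in blast)
  have "inj_on ?f (topspace X)"
  proof (rule inj_onI, rule ccontr)
    fix x y assume xy: "x \<in> topspace X" "y \<in> topspace X" "?f x = ?f y" "x \<noteq> y"
    then obtain V where "V \<in> \<N>" "x \<in> V" "y \<notin> V"
      using base_of_separation[OF X base] by metis
    then show False
      using fun_cong[OF xy(3), of V] by simp
  qed
  moreover have "open_map X (subtopology ?Y (?f ` topspace X)) ?f"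
    unfolding open_map_def
  proof (intro allI impI)
    fix U assume U: "openin X U"
    let ?W = "\<Union>V\<in>{V \<in> \<N>. V \<subseteq> U}. {\<phi> \<in> topspace ?Y. \<phi> V}"
    have "openin ?Y ?W"
      using bY unfolding base_of_def by (intro openin_Union) blast
    moreover have "?f ` U = ?W \<inter> ?f ` topspace X"
    proof (intro equalityI subsetI)
      fix \<phi> assume "\<phi> \<in> ?f ` U"
      then obtain x where x: "x \<in> U" "\<phi> = ?f x"
        by blast
      have xt: "x \<in> topspace X"
        using x U openin_subset by blast
      obtain V where V: "V \<in> \<N>" "x \<in> V" "V \<subseteq> U"
        using base U x(1) unfolding base_of_def by meson
      then have "\<phi> V"
        using x by simp
      then show "\<phi> \<in> ?W \<inter> ?f ` topspace X"
        using V x xt fY[OF xt] by blast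
    next
      fix \<phi> assume "\<phi> \<in> ?W \<inter> ?f ` topspace X"
      then obtain x V where "x \<in> topspace X" "\<phi> = ?f x" "V \<in> \<N>" "V \<subseteq> U" "\<phi> V"
        by blast
      then show "\<phi> \<in> ?f ` U"
        by auto
    qed
    ultimately show "openin (subtopology ?Y (?f ` topspace X)) (?f ` U)"
      unfolding openin_subtopology by blast
  qed
  moreover have "topspace (subtopology ?Y (?f ` topspace X)) = ?f ` topspace X"
    using fY by auto
  ultimately show ?thesis
    unfolding embedding_map_def
    using cont by (intro bijective_open_imp_homeomorphic_map) (auto simp: continuous_map_in_subtopology)
qed

text \<open>Finitely many members of a branch contain a common nonempty member, so branches are
  centered. A point in all members of \<open>b\<close> determines a branch that contains
  \<open>b\<close>, and maximality gives equality.\<close>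

lemma embedding_onto_branch_space:
  assumes X: "Hausdorff_space X" and tb: "tree_base X \<N>" and compl: "complete_family X \<N>"
  shows "(\<lambda>x. \<lambda>V\<in>\<N>. x \<in> V) ` topspace X = topspace (branch_space (reverse_inclusion \<N>))"
proof
  let ?T = "reverse_inclusion \<N>"
  let ?f = "\<lambda>x. \<lambda>V\<in>\<N>. x \<in> V"
  show "?f ` topspace X \<subseteq> topspace (branch_space ?T)"
    using homeomorphic_imp_surjective_map[OF embedding_into_branch_space[OF X tb, unfolded embedding_map_def]]
    unfolding topspace_subtopology by (rule subset_trans[OF equalityD1 Int_lower1])
  have "topspace X \<noteq> {}"
    using compl unfolding complete_family_def centered_def
    by (metis empty_subsetI inf_bot_left subset_empty)
  then have ne: "{} \<notin> \<N>"
    using tb by (simp add: tree_base_def)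
  show "topspace (branch_space ?T) \<subseteq> ?f ` topspace X"
  proof
    fix \<phi> assume "\<phi> \<in> topspace (branch_space ?T)"
    then obtain b where b: "branch ?T b" "\<phi> = (\<lambda>V\<in>\<N>. V \<in> b)"
      by (auto simp: topspace_branch_space)
    have bN: "b \<subseteq> \<N>"
      using branch_subset_Field[OF b(1)] by simp
    have "centered b"
      unfolding centered_def
    proof (intro allI impI, elim conjE)
      fix \<F> assume F: "\<F> \<subseteq> b" "finite \<F>"
      then obtain t where "t \<in> b" "\<And>s. s \<in> \<F> \<Longrightarrow> (s, t) \<in> ?T"
        using finite_subset_branch_le[OF tree_reverse_inclusion[OF tb] b(1)] by metis
      then have "t \<subseteq> \<Inter>\<F>" "t \<noteq> {}"
        using ne bN by auto
      then show "\<Inter>\<F> \<noteq> {}"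
        by blast
    qed
    then obtain x where x: "x \<in> topspace X" "x \<in> \<Inter>b"
      using compl bN unfolding complete_family_def by blast
    then have "b = {V \<in> \<N>. x \<in> V}"
      using b(1) bN branch_of_point[OF X tb x(1)] unfolding branch_def by blast
    then have "\<phi> = ?f x"
      using b(2) by (auto simp: restrict_def)
    then show "\<phi> \<in> ?f ` topspace X"
      using x(1) by blast
  qed
qed

text \<open>The constructed tree has subsets of the space as nodes, which fixes the type
  \<open>'a set rel\<close> in the equivalences. Necessity is also stated for trees over an
  arbitrary type \<open>'b\<close>.\<close>

theorem theorem3p12:
  fixes X :: "'a topology"
  assumes "Hausdorff_space X"
  shows "
    ((\<exists>T :: 'a set rel. tree T \<and> embeds_in X (branch_space T)) \<longleftrightarrow>
       (\<exists>\<B>. base_of X \<B> \<and> nested \<B>)) \<and>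
    ((\<exists>T :: 'b rel. tree T \<and> embeds_in X (branch_space T)) \<longrightarrow>
       (\<exists>\<B>. base_of X \<B> \<and> nested \<B>)) \<and>

    ((\<exists>T :: 'a set rel. tree T \<and> special T \<and> embeds_in X (branch_space T)) \<longleftrightarrow>
       (\<exists>\<B>. base_of X \<B> \<and> nested \<B> \<and> sigma_disjoint \<B>)) \<and>
    ((\<exists>T :: 'b rel. tree T \<and> special T \<and> embeds_in X (branch_space T)) \<longrightarrow>
       (\<exists>\<B>. base_of X \<B> \<and> nested \<B> \<and> sigma_disjoint \<B>)) \<and>

    ((\<exists>T :: 'a set rel. tree T \<and> embeds_onto X (branch_space T)) \<longleftrightarrow>
       (\<exists>\<B>. base_of X \<B> \<and> nested \<B> \<and> complete_family X \<B>)) \<and>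
    ((\<exists>T :: 'b rel. tree T \<and> embeds_onto X (branch_space T)) \<longrightarrow>
       (\<exists>\<B>. base_of X \<B> \<and> nested \<B> \<and> complete_family X \<B>)) \<and>

    ((\<exists>T :: 'a set rel. tree T \<and> special T \<and> embeds_onto X (branch_space T)) \<longleftrightarrow>
       (\<exists>\<B>. base_of X \<B> \<and> nested \<B> \<and> complete_family X \<B> \<and> sigma_disjoint \<B>)) \<and>
    ((\<exists>T :: 'b rel. tree T \<and> special T \<and> embeds_onto X (branch_space T)) \<longrightarrow>
       (\<exists>\<B>. base_of X \<B> \<and> nested \<B> \<and> complete_family X \<B> \<and> sigma_disjoint \<B>))"
proof -
  have necessity: "\<exists>\<B>. base_of X \<B> \<and> nested \<B> \<and> (special T \<longrightarrow> sigma_disjoint \<B>) \<and>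
      (f ` topspace X = topspace (branch_space T) \<longrightarrow> complete_family X \<B>)"
    if "tree T" "embedding_map X (branch_space T) f" for T :: "'d rel" and f
    using nested_base_of_embedding[OF that] by metis
  have sufficiency: "\<exists>T :: 'a set rel. tree T \<and> (sigma_disjoint \<B> \<longrightarrow> special T) \<and>
      (\<exists>f. embedding_map X (branch_space T) f \<and>
        (complete_family X \<B> \<longrightarrow> f ` topspace X = topspace (branch_space T)))"
    if \<B>: "base_of X \<B>" "nested \<B>" for \<B>
  proof -
    obtain \<N> where \<N>: "tree_base X \<N>"
      "sigma_disjoint \<B> \<Longrightarrow> sigma_disjoint \<N>" "complete_family X \<B> \<Longrightarrow> complete_family X \<N>"
      using tree_base_exists[OF assms \<B>] by metis
    show ?thesis
      using tree_reverse_inclusion[OF \<N>(1)] special_reverse_inclusion[OF \<N>(1)]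
        embedding_into_branch_space[OF assms \<N>(1)] embedding_onto_branch_space[OF assms \<N>(1)] \<N>(2,3)
      by meson
  qed
  show ?thesis
    unfolding embeds_in_def embeds_onto_def
    apply (intro conjI iffI impI; elim exE conjE)
    subgoal by (drule (1) necessity) blast
    subgoal by (drule (1) sufficiency) blast
    subgoal by (drule (1) necessity) blast
    subgoal by (drule (1) necessity) blast
    subgoal by (drule (1) sufficiency) blast
    subgoal by (drule (1) necessity) blast
    subgoal by (drule (1) necessity) blast
    subgoal by (drule (1) sufficiency) blast
    subgoal by (drule (1) necessity) blast
    subgoal by (drule (1) necessity) blast
    subgoal by (drule (1) sufficiency) blast
    subgoal by (drule (1) necessity) blast
    done
qed

end
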